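(* Let $A$ be an $n\times n$ matrix with pairwise distinct entries from a totally ordered set, and let $s\le n$ be a positive integer. Let $f:\mathbb{N}\to[0,1]$ be a decreasing function. Assume that the subroutine $\textsc{FindHorizontalPivot}$ (resp. $\textsc{FindVerticalPivot}$), when called on an $m\times m$ or $m\times\lceil 3m/4\rceil$ matrix, runs in $O(m)$ time, outputs either a horizontal (resp. vertical) pivot of that matrix or \textsc{Failed}, and outputs a horizontal (resp. vertical) pivot with probability at least $1-f(m)$. Then $\textsc{ReduceMatrix}(A,s)$ runs in $O(n)$ time and, with probability at least $1-O\!\left(f(s)\log\frac{n}{s}\right)$, returns an $s'\times s'$ submatrix $A'$ of $A$ with $s'\le s$. Moreover, if $A$ has a strict saddlepoint, then (whenever a submatrix is returned) $A'$ has the same strict saddlepoint.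
   Context: For a matrix $B$, a saddlepoint is an entry that is the maximum of its row and the minimum of its column; a strict saddlepoint is an entry that is the strict maximum of its row and the strict minimum of its column. An entry $B_{ij}$ is a horizontal pivot of $B$ if every row of $B$ contains an entry at least as large as $B_{ij}$, and at least a quarter of the entries in row $i$ are smaller than $B_{ij}$. An entry $B_{ij}$ is a vertical pivot of $B$ if every column of $B$ contains an entry at most as large as $B_{ij}$, and at least a quarter of the entries in column $j$ are larger than $B_{ij}$. The procedure $\textsc{ReduceMatrix}(A,s)$ is: while the number of rows of $A$ exceeds $s$: compute $(i,j)\gets\textsc{FindHorizontalPivot}(A)$ and delete $\lfloor \mathrm{width}(A)/4\rfloor$ columns $j'$ of $A$ with $A_{ij'}<A_{ij}$; then compute $(i,j)\gets\textsc{FindVerticalPivot}(A)$ and delete $\lfloor\mathrm{height}(A)/4\rfloor$ rows $i'$ of $A$ with $A_{i'j}>A_{ij}$; if either pivot-finding call outputs \textsc{Failed}, return \textsc{Failed}. When the loop ends, return the current matrix $A$. Matrix entries are accessed only via unit-cost binary comparisons.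
   Formalization: Time and probability claims are proved for s ≥ 3 or s = n (for s ≤ 2 < or s < n the loop may never end, as floor(m/4) = 0 for m ≤ 3), and log(n/s) is replaced by ⌈log2(n/s)⌉, since the literal bound fails when s < n < 2s (e.g. s = n−1). *)

theory Defs
  imports "HOL-Probability.SPMF" "Jordan_Normal_Form.DL_Submatrix"
begin

section \<open>Matrices, saddlepoints and pivots\<close>

definition distinct_entries :: "'a mat \<Rightarrow> bool" where
  "distinct_entries B \<longleftrightarrow> inj_on (\<lambda>p. B $$ p) ({..<dim_row B} \<times> {..<dim_col B})"

definition strict_saddlepoint :: "'a::linorder mat \<Rightarrow> nat \<Rightarrow> nat \<Rightarrow> bool" where
  "strict_saddlepoint B i j \<longleftrightarrow> i < dim_row B \<and> j < dim_col B \<and>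
     (\<forall>j' < dim_col B. j' \<noteq> j \<longrightarrow> B $$ (i, j') < B $$ (i, j)) \<and>
     (\<forall>i' < dim_row B. i' \<noteq> i \<longrightarrow> B $$ (i, j) < B $$ (i', j))"

definition horizontal_pivot :: "'a::linorder mat \<Rightarrow> nat \<Rightarrow> nat \<Rightarrow> bool" where
  "horizontal_pivot B i j \<longleftrightarrow> i < dim_row B \<and> j < dim_col B \<and>
     (\<forall>i' < dim_row B. \<exists>j' < dim_col B. B $$ (i, j) \<le> B $$ (i', j')) \<and>
     real (dim_col B) / 4 \<le> real (card {j'. j' < dim_col B \<and> B $$ (i, j') < B $$ (i, j)})"

definition vertical_pivot :: "'a::linorder mat \<Rightarrow> nat \<Rightarrow> nat \<Rightarrow> bool" where
  "vertical_pivot B i j \<longleftrightarrow> i < dim_row B \<and> j < dim_col B \<and>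
     (\<forall>j' < dim_col B. \<exists>i' < dim_row B. B $$ (i', j') \<le> B $$ (i, j)) \<and>
     real (dim_row B) / 4 \<le> real (card {i'. i' < dim_row B \<and> B $$ (i, j) < B $$ (i', j)})"

definition square_submatrix :: "'a mat \<Rightarrow> nat \<Rightarrow> 'a mat \<Rightarrow> bool" where
  "square_submatrix A' s' A \<longleftrightarrow> 0 < s' \<and>
     (\<exists>I J. I \<subseteq> {..<dim_row A} \<and> J \<subseteq> {..<dim_col A} \<and> card I = s' \<and> card J = s' \<and>
        A' = submatrix A I J)"

section \<open>Randomized computations with running time\<close>

text \<open>A run yields a result together with its running time; the mass missing from the
  subprobability is the probability that the computation does not terminate.\<close>

type_synonym 'r timed = "('r \<times> nat) spmf"

definition return_timed :: "'r \<Rightarrow> 'r timed" where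
  "return_timed x = return_spmf (x, 0)"

definition bind_timed :: "'r timed \<Rightarrow> ('r \<Rightarrow> 'q timed) \<Rightarrow> 'q timed" where
  "bind_timed p k = bind_spmf p (\<lambda>(x, t). map_spmf (\<lambda>(y, u). (y, t + u)) (k x))"

definition tick :: "nat \<Rightarrow> unit timed" where
  "tick t = return_spmf ((), t)"

definition compare_less :: "'a::linorder \<Rightarrow> 'a \<Rightarrow> bool timed" where
  "compare_less x y = return_spmf (x < y, 1)"

definition runs_in_time :: "'r timed \<Rightarrow> real \<Rightarrow> bool" where
  "runs_in_time p T \<longleftrightarrow> lossless_spmf p \<and> (\<forall>(r, t) \<in> set_spmf p. real t \<le> T)"

lemma bind_timed_mono [partial_function_mono]:
  assumes "mono_spmf B" and "\<And>y. mono_spmf (\<lambda>f. C y f)"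
  shows "mono_spmf (\<lambda>f. bind_timed (B f) (\<lambda>y. C y f))"
  unfolding bind_timed_def case_prod_unfold
  by (intro bind_spmf_mono map_spmf_mono assms)

section \<open>The reduction procedure\<close>

text \<open>\<open>None\<close> stands for the output FAILED.\<close>

type_synonym 'a pivot_algorithm = "'a mat \<Rightarrow> (nat \<times> nat) option timed"

definition pivot_finder ::
  "('a::linorder mat \<Rightarrow> nat \<Rightarrow> nat \<Rightarrow> bool) \<Rightarrow> real \<Rightarrow> (nat \<Rightarrow> real) \<Rightarrow> 'a pivot_algorithm \<Rightarrow> bool"
where
  "pivot_finder is_pivot c f find_pivot \<longleftrightarrow>
     (\<forall>m B. 0 < m \<and> (B \<in> carrier_mat m m \<or> B \<in> carrier_mat m (nat \<lceil>3 * real m / 4\<rceil>)) \<and>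
        distinct_entries B \<longrightarrow>
          runs_in_time (find_pivot B) (c * real m) \<and>
          (\<forall>(r, t) \<in> set_spmf (find_pivot B). r = None \<or> (\<exists>i j. r = Some (i, j) \<and> is_pivot B i j)) \<and>
          1 - f m \<le> measure (measure_spmf (find_pivot B))
                      {(r, t). \<exists>i j. r = Some (i, j) \<and> is_pivot B i j})"

text \<open>The rule by which the \<open>k\<close> rows or columns to be deleted are picked from the list of all
  candidates is left open.\<close>

type_synonym selection_rule = "nat \<Rightarrow> nat list \<Rightarrow> nat set"

definition valid_selection :: "selection_rule \<Rightarrow> bool" where
  "valid_selection sel \<longleftrightarrow>
     (\<forall>k xs. distinct xs \<and> k \<le> length xs \<longrightarrow> sel k xs \<subseteq> set xs \<and> card (sel k xs) = k)"

primrec filter_timed :: "('x \<Rightarrow> bool timed) \<Rightarrow> 'x list \<Rightarrow> 'x list timed" where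
  "filter_timed P [] = return_timed []"
| "filter_timed P (x # xs) =
     bind_timed (P x) (\<lambda>b.
     bind_timed (filter_timed P xs) (\<lambda>ys.
     return_timed (if b then x # ys else ys)))"

text \<open>In the two deletion steps, the entries are accessed by one unit-cost comparison per column
  (row); the tick charges for the remaining handling of the column (row) indices.\<close>

definition delete_columns :: "selection_rule \<Rightarrow> 'a::linorder mat \<Rightarrow> nat \<Rightarrow> nat \<Rightarrow> 'a mat timed" where
  "delete_columns sel B i j =
     bind_timed (filter_timed (\<lambda>j'. compare_less (B $$ (i, j')) (B $$ (i, j))) [0..<dim_col B]) (\<lambda>js.
     bind_timed (tick (dim_col B)) (\<lambda>_.
     return_timed (submatrix B UNIV (- sel (dim_col B div 4) js))))"

definition delete_rows :: "selection_rule \<Rightarrow> 'a::linorder mat \<Rightarrow> nat \<Rightarrow> nat \<Rightarrow> 'a mat timed" where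
  "delete_rows sel B i j =
     bind_timed (filter_timed (\<lambda>i'. compare_less (B $$ (i, j)) (B $$ (i', j))) [0..<dim_row B]) (\<lambda>is.
     bind_timed (tick (dim_row B)) (\<lambda>_.
     return_timed (submatrix B (- sel (dim_row B div 4) is) UNIV)))"

partial_function (spmf) reduce_matrix ::
  "'a::linorder pivot_algorithm \<Rightarrow> 'a pivot_algorithm \<Rightarrow> selection_rule \<Rightarrow> selection_rule \<Rightarrow>
   'a mat \<Rightarrow> nat \<Rightarrow> 'a mat option timed"
where
  "reduce_matrix find_h find_v sel_col sel_row A s =
     bind_timed (tick 1) (\<lambda>_.
     if dim_row A \<le> s then return_timed (Some A)
     else
       bind_timed (find_h A) (\<lambda>p. case p of
         None \<Rightarrow> return_timed None
       | Some (i, j) \<Rightarrow>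
           bind_timed (delete_columns sel_col A i j) (\<lambda>A1.
           bind_timed (find_v A1) (\<lambda>q. case q of
             None \<Rightarrow> return_timed None
           | Some (i', j') \<Rightarrow>
               bind_timed (delete_rows sel_row A1 i' j') (\<lambda>A2.
               reduce_matrix find_h find_v sel_col sel_row A2 s)))))"

end

theory Submission
  imports Defs
begin

text \<open>Each iteration shrinks an \<open>m \<times> m\<close> matrix with \<open>m \<ge> 4\<close> to side length at most \<open>6 m / 7\<close> in
  time linear in \<open>m\<close>, so the total time is a geometric series. As \<open>(6 / 7) ^ 5 < 1 / 2\<close>, at most five
  iterations are needed per halving; each of them fails with probability at most \<open>2 f m \<le> 2 f s\<close>,
  and a union bound gives the constant 10. The pivots guarantee that neither the row nor the column
  of a strict saddlepoint is deleted; since the loop need not terminate for \<open>s < 3\<close>, this is shown by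
  fixed-point induction and not along the iteration count.\<close>

section \<open>Submatrices\<close>

lemma pick_less:
  assumes "I \<subseteq> {..<d}" "i < card I"
  shows "pick I i < d"
  using assms pick_in_set_le by blast

lemma inj_on_pick: "inj_on (pick I) {..<card I}"
  by (rule inj_onI) (metis lessThan_iff nat_neq_iff pick_mono_le)

lemma pick_eqI:
  assumes "x \<in> I" "card {a\<in>I. a < x} = i"
  shows "pick I i = x"
  using pick_card_in_set[OF assms(1)] assms(2) by simp

text \<open>On \<open>{..<card I}\<close> the map \<open>pick I\<close> is strictly increasing, so
  it preserves ranks: \<open>pick I (pick K i)\<close> has as many predecessors in the image as
  \<open>pick K i\<close> has in \<open>K\<close>, namely \<open>i\<close>.\<close>

lemma pick_image_pick:
  assumes "K \<subseteq> {..<card I}" "i < card K"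
  shows "pick (pick I ` K) i = pick I (pick K i)"
proof (rule pick_eqI)
  have K: "pick K i \<in> K" using assms(2) by (rule pick_in_set_le)
  then show "pick I (pick K i) \<in> pick I ` K" by blast
  have lt: "pick I a < pick I b \<longleftrightarrow> a < b" if "a \<in> K" "b \<in> K" for a b
    using that assms(1) pick_mono_le[of a I b] pick_mono_le[of b I a]
    by (metis lessThan_iff less_asym' linorder_neqE_nat subset_eq)
  then have "{a \<in> pick I ` K. a < pick I (pick K i)} = pick I ` {a \<in> K. a < pick K i}"
    using K by auto
  moreover have "inj_on (pick I) {a \<in> K. a < pick K i}"
    by (rule inj_onI) (metis (no_types, lifting) lt mem_Collect_eq nat_neq_iff)
  ultimately show "card {a \<in> pick I ` K. a < pick I (pick K i)} = i"
    by (simp add: card_image card_pick_le[OF assms(2)])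
qed

text \<open>The deletion steps use \<open>UNIV\<close> and complements as index sets. Cutting these
  down to the actual index ranges makes them finite, so that their cardinalities are the dimensions
  of the result.\<close>

lemma submatrix_restrict:
  "submatrix A I J = submatrix A (I \<inter> {..<dim_row A}) (J \<inter> {..<dim_col A})"
proof -
  have *: "{i. i < d \<and> i \<in> K \<inter> {..<d}} = {i. i < d \<and> i \<in> K}"
    "{i. i < d \<and> i \<in> K} = K \<inter> {..<d}" for K and d :: nat by auto
  show ?thesis
    unfolding submatrix_def *(1)
    by (rule cong_mat)
      (auto simp: pick_reduce_set[of _ "dim_row A" I] pick_reduce_set[of _ "dim_col A" J] *(2))
qed

lemma submatrix_eq_mat:
  assumes "I \<subseteq> {..<dim_row A}" "J \<subseteq> {..<dim_col A}"
  shows "submatrix A I J = mat (card I) (card J) (\<lambda>(i, j). A $$ (pick I i, pick J j))"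
proof -
  have "{i. i < dim_row A \<and> i \<in> I} = I" "{j. j < dim_col A \<and> j \<in> J} = J"
    using assms by auto
  then show ?thesis by (simp add: submatrix_def)
qed

text \<open>Submatrices compose by transporting the inner index sets along \<open>pick\<close>; this
  makes the result of many iterations a submatrix of the original input.\<close>

lemma submatrix_submatrix:
  assumes "I \<subseteq> {..<dim_row A}" "J \<subseteq> {..<dim_col A}" "K \<subseteq> {..<card I}" "L \<subseteq> {..<card J}"
  shows "submatrix (submatrix A I J) K L = submatrix A (pick I ` K) (pick J ` L)"
proof -
  have sub: "pick I ` K \<subseteq> {..<dim_row A}" "pick J ` L \<subseteq> {..<dim_col A}"
    using assms pick_in_set_le by blast+
  have card: "card (pick I ` K) = card K" "card (pick J ` L) = card L"
    using assms inj_on_pick by (metis card_image inj_on_subset)+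
  show ?thesis
    by (rule eq_matI)
      (use assms in \<open>simp_all add: submatrix_eq_mat sub card pick_image_pick pick_less\<close>)
qed

section \<open>Properties inherited by submatrices: distinct entries and strict saddlepoints\<close>

lemma distinct_entries_submatrix:
  assumes "distinct_entries A" "I \<subseteq> {..<dim_row A}" "J \<subseteq> {..<dim_col A}"
  shows "distinct_entries (submatrix A I J)"
  unfolding distinct_entries_def
proof (rule inj_onI)
  fix p q
  let ?D = "{..<dim_row (submatrix A I J)} \<times> {..<dim_col (submatrix A I J)}"
  assume pq: "p \<in> ?D" "q \<in> ?D" "submatrix A I J $$ p = submatrix A I J $$ q"
  obtain i j k l where ij: "p = (i, j)" "q = (k, l)" by fastforce
  have lt: "i < card I" "j < card J" "k < card I" "l < card J"
    using pq(1,2) by (auto simp: ij submatrix_eq_mat assms(2,3))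
  have "A $$ (pick I i, pick J j) = A $$ (pick I k, pick J l)"
    using pq(3) lt by (simp add: ij submatrix_eq_mat assms(2,3))
  then have "(pick I i, pick J j) = (pick I k, pick J l)"
    using assms(1) lt pick_less[OF assms(2)] pick_less[OF assms(3)]
    unfolding distinct_entries_def by (auto dest: inj_onD)
  then show "p = q"
    using lt inj_onD[OF inj_on_pick] by (auto simp: ij)
qed

text \<open>The saddlepoint moves to the ranks of \<open>i\<close> in \<open>I\<close> and of
  \<open>j\<close> in \<open>J\<close>. Every other position of its new row or column comes from
  another column or row of \<open>A\<close>, so the strict inequalities carry over.\<close>

lemma strict_saddlepoint_submatrix:
  assumes "strict_saddlepoint A i j" "i \<in> I" "j \<in> J"
    and sub: "I \<subseteq> {..<dim_row A}" "J \<subseteq> {..<dim_col A}"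
  obtains i' j' where "strict_saddlepoint (submatrix A I J) i' j'"
    "submatrix A I J $$ (i', j') = A $$ (i, j)"
proof -
  have rank: "card {a\<in>S. a < x} < card S" "pick S (card {a\<in>S. a < x}) = x"
    if "x \<in> S" "S \<subseteq> {..<d}" for S x and d :: nat
    using that finite_subset[OF that(2)] by (auto intro!: psubset_card_mono pick_card_in_set)
  let ?i = "card {a\<in>I. a < i}" and ?j = "card {a\<in>J. a < j}"
  note r = rank[OF assms(2) sub(1)] rank[OF assms(3) sub(2)]
  have "pick I i' \<noteq> i" if "i' \<noteq> ?i" "i' < card I" for i'
    using that card_pick_le[of i' I] by auto
  moreover have "pick J j' \<noteq> j" if "j' \<noteq> ?j" "j' < card J" for j'
    using that card_pick_le[of j' J] by auto
  ultimately have "strict_saddlepoint (submatrix A I J) ?i ?j"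
    using assms(1) r pick_less[OF sub(1)] pick_less[OF sub(2)]
    unfolding strict_saddlepoint_def by (simp add: submatrix_eq_mat[OF sub])
  moreover have "submatrix A I J $$ (?i, ?j) = A $$ (i, j)"
    by (simp add: submatrix_eq_mat[OF sub] r)
  ultimately show ?thesis by (rule that)
qed

text \<open>The relation that each deletion step establishes and that composes along the loop.
  Positions shift under deletion, so sameness of a saddlepoint is expressed by its value.\<close>

definition saddle_submatrix :: "'a::linorder mat \<Rightarrow> 'a mat \<Rightarrow> bool" where
  "saddle_submatrix A B \<longleftrightarrow>
     (\<exists>I J. I \<subseteq> {..<dim_row A} \<and> J \<subseteq> {..<dim_col A} \<and> B = submatrix A I J) \<and>
     (\<forall>i j. strict_saddlepoint A i j \<longrightarrow>
        (\<exists>i' j'. strict_saddlepoint B i' j' \<and> B $$ (i', j') = A $$ (i, j)))"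

lemma saddle_submatrix_refl: "saddle_submatrix A A"
proof -
  \<comment> \<open>\<open>pick UNIV\<close> is the identity; the restriction afterwards supplies
    the bounded index sets which the definition asks for.\<close>
  have "A = submatrix A UNIV UNIV"
    by (rule eq_matI) (simp_all add: submatrix_def pick_UNIV)
  then have "A = submatrix A {..<dim_row A} {..<dim_col A}"
    using submatrix_restrict[of A UNIV UNIV] by simp
  then show ?thesis unfolding saddle_submatrix_def by blast
qed

lemma saddle_submatrix_trans:
  assumes "saddle_submatrix A B" "saddle_submatrix B C"
  shows "saddle_submatrix A C"
proof -
  obtain I J where IJ: "I \<subseteq> {..<dim_row A}" "J \<subseteq> {..<dim_col A}" "B = submatrix A I J"
    using assms(1) unfolding saddle_submatrix_def by blast
  obtain K L where KL: "K \<subseteq> {..<dim_row B}" "L \<subseteq> {..<dim_col B}" "C = submatrix B K L"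
    using assms(2) unfolding saddle_submatrix_def by blast
  have KL': "K \<subseteq> {..<card I}" "L \<subseteq> {..<card J}"
    using KL(1,2) by (simp_all add: IJ submatrix_eq_mat)
  then have "C = submatrix A (pick I ` K) (pick J ` L)"
    using submatrix_submatrix[OF IJ(1,2) KL'] by (simp add: IJ(3) KL(3))
  moreover have "pick I ` K \<subseteq> {..<dim_row A}" "pick J ` L \<subseteq> {..<dim_col A}"
    using IJ KL' pick_in_set_le by blast+
  ultimately show ?thesis
    using assms unfolding saddle_submatrix_def by metis
qed

lemma distinct_entries_saddle_submatrix:
  "saddle_submatrix A B \<Longrightarrow> distinct_entries A \<Longrightarrow> distinct_entries B"
  unfolding saddle_submatrix_def using distinct_entries_submatrix by blast

lemma square_submatrix_saddle_submatrix:
  assumes "saddle_submatrix A B" "dim_row B = dim_col B" "0 < dim_row B"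
  shows "square_submatrix B (dim_row B) A"
proof -
  obtain I J where IJ: "I \<subseteq> {..<dim_row A}" "J \<subseteq> {..<dim_col A}" "B = submatrix A I J"
    using assms(1) unfolding saddle_submatrix_def by blast
  then have "dim_row B = card I" "dim_col B = card J"
    by (simp_all add: submatrix_eq_mat)
  then show ?thesis
    unfolding square_submatrix_def using assms(2,3) IJ by metis
qed

section \<open>Timed computations\<close>

lemma measure_bind_spmf:
  "measure (measure_spmf (bind_spmf p k)) X = (\<integral>x. measure (measure_spmf (k x)) X \<partial>measure_spmf p)"
  unfolding measure_spmf_bind o_def
  by (rule subprob_space.measure_bind[where N="count_space UNIV"])
    (auto simp: subprob_space_measure_spmf space_measure_spmf)

lemma measure_return_spmf: "measure (measure_spmf (return_spmf x)) X = indicator X x"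
  by (simp add: measure_spmf_return_spmf measure_return)

lemma set_bind_timed:
  "set_spmf (bind_timed p k) = {(y, t + u) |x t y u. (x, t) \<in> set_spmf p \<and> (y, u) \<in> set_spmf (k x)}"
  unfolding bind_timed_def by (force simp: set_bind_spmf o_def)

lemma bind_timed_return_spmf:
  "bind_timed (return_spmf (x, t)) k = map_spmf (\<lambda>(y, u). (y, t + u)) (k x)"
  by (simp add: bind_timed_def)

lemma runs_in_time_return_spmf: "runs_in_time (return_spmf (x, t)) T \<longleftrightarrow> real t \<le> T"
  by (simp add: runs_in_time_def)

text \<open>The continuation is bounded only on the support of \<open>p\<close>, so its time bound
  may rely on the pivot found being correct.\<close>

lemma runs_in_time_bind_timed:
  assumes "runs_in_time p T" "\<And>x t. (x, t) \<in> set_spmf p \<Longrightarrow> runs_in_time (k x) U" "T + U \<le> V"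
  shows "runs_in_time (bind_timed p k) V"
  unfolding runs_in_time_def
proof (intro conjI)
  show "lossless_spmf (bind_timed p k)"
    using assms(1,2) by (auto simp: bind_timed_def runs_in_time_def)
  show "\<forall>(r, t)\<in>set_spmf (bind_timed p k). real t \<le> V"
    using assms by (fastforce simp: set_bind_timed runs_in_time_def)
qed

text \<open>The union bound in sequential form: failure probabilities add, as
  \<open>(1 - d) * (1 - e)\<close> is at least \<open>1 - d - e\<close>. Nontermination counts as
  failure.\<close>

lemma measure_bind_timed_ge:
  assumes p: "1 - d \<le> measure (measure_spmf p) {(x, t). P x}"
    and k: "\<And>x t. (x, t) \<in> set_spmf p \<Longrightarrow> P x \<Longrightarrow> 1 - e \<le> measure (measure_spmf (k x)) {(y, t). Q y}"
    and "0 \<le> d" "0 \<le> e" "d + e \<le> b"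
  shows "1 - b \<le> measure (measure_spmf (bind_timed p k)) {(y, t). Q y}"
\<comment> \<open>For \<open>e > 1\<close> the claimed lower bound is negative; otherwise
  \<open>1 - e\<close> is nonnegative and may be multiplied into inequalities.\<close>
proof (cases "e \<le> 1")
  case False
  then have "1 - b \<le> 0" using assms by linarith
  then show ?thesis using measure_nonneg order_trans by blast
next
  case True
  let ?X = "{(y, t). Q y}" and ?P = "{(x, t). P x}"
  have pre: "(\<lambda>(y, u). (y, t + u)) -` ?X = ?X" for t :: nat by auto
  have "1 - b \<le> (1 - e) * (1 - d)"
    using mult_nonneg_nonneg[OF assms(3,4)] assms(5) by (simp add: algebra_simps)
  also have "\<dots> \<le> (1 - e) * measure (measure_spmf p) ?P"
    using p True by (intro mult_left_mono) auto
  also have "\<dots> = (\<integral>z. (1 - e) * indicator ?P z \<partial>measure_spmf p)"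
    by simp
  \<comment> \<open>Pointwise on the support: inside \<open>?P\<close> this is the assumption on
    \<open>k\<close>, outside the left integrand is zero. Both are bounded by 1, hence
    integrable.\<close>
  also have "\<dots> \<le> (\<integral>z. measure (measure_spmf (k (fst z))) ?X \<partial>measure_spmf p)"
    using True k
    by (intro integral_mono_AE)
      (auto intro!: measure_spmf.integrable_const_bound[where B=1]
        simp: AE_measure_spmf_iff indicator_def measure_spmf.subprob_measure_le_1)
  also have "\<dots> = measure (measure_spmf (bind_timed p k)) ?X"
    unfolding bind_timed_def measure_bind_spmf
    by (intro Bochner_Integration.integral_cong refl)
      (auto simp: measure_map_spmf pre simp del: vimage_Collect_eq)
  finally show ?thesis .
qed

lemma filter_timed_compare_less:
  "filter_timed (\<lambda>x. compare_less (g x) (h x)) xs = return_spmf (filter (\<lambda>x. g x < h x) xs, length xs)"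
  by (induction xs) (auto simp: return_timed_def compare_less_def bind_timed_return_spmf)

section \<open>Deleting rows and columns\<close>

text \<open>Scan and tick are deterministic, so the deletion is a point mass; the cost is one
  comparison plus one unit of index handling per column.\<close>

lemma delete_columns_eq:
  "delete_columns sel B i j = return_spmf (submatrix B UNIV
     (- sel (dim_col B div 4) (filter (\<lambda>j'. B $$ (i, j') < B $$ (i, j)) [0..<dim_col B])), 2 * dim_col B)"
  by (simp add: delete_columns_def filter_timed_compare_less bind_timed_return_spmf tick_def
      return_timed_def)

lemma delete_rows_eq:
  "delete_rows sel B i j = return_spmf (submatrix B
     (- sel (dim_row B div 4) (filter (\<lambda>i'. B $$ (i, j) < B $$ (i', j)) [0..<dim_row B])) UNIV, 2 * dim_row B)"
  by (simp add: delete_rows_def filter_timed_compare_less bind_timed_return_spmf tick_def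
      return_timed_def)

text \<open>The quarter condition in the definition of a pivot guarantees at least
  \<open>d div 4\<close> candidates, which is what \<open>valid_selection\<close> requires.\<close>

lemma valid_selection_filter:
  assumes "valid_selection sel" "real d / 4 \<le> real (card {x. x < d \<and> P x})"
  shows "sel (d div 4) (filter P [0..<d]) \<subseteq> {x. x < d \<and> P x}"
    and "card ({..<d} - sel (d div 4) (filter P [0..<d])) = d - d div 4"
proof -
  let ?xs = "filter P [0..<d]"
  have set: "set ?xs = {x. x < d \<and> P x}" by auto
  have "length ?xs = card {x. x < d \<and> P x}"
    using distinct_card[of ?xs] set by simp
  then have "d div 4 \<le> length ?xs" using assms(2) by linarith
  then have sel: "sel (d div 4) ?xs \<subseteq> set ?xs \<and> card (sel (d div 4) ?xs) = d div 4"
    using assms(1) unfolding valid_selection_def by (metis distinct_filter distinct_upt)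
  then show "sel (d div 4) ?xs \<subseteq> {x. x < d \<and> P x}" using set by simp
  then have "sel (d div 4) ?xs \<subseteq> {..<d}" by auto
  then show "card ({..<d} - sel (d div 4) ?xs) = d - d div 4"
    using sel by (simp add: card_Diff_subset finite_subset)
qed

text \<open>The row of a strict saddlepoint contains an entry at least as large as the horizontal pivot, so
  the saddlepoint is at least as large too, and its column meets the pivot row in an entry which is
  again at least as large. Hence that column is not a candidate for deletion.\<close>

lemma delete_columns_horizontal_pivot:
  assumes piv: "horizontal_pivot B i j" and sel: "valid_selection sel"
  obtains B' where "delete_columns sel B i j = return_spmf (B', 2 * dim_col B)"
    "dim_row B' = dim_row B" "dim_col B' = dim_col B - dim_col B div 4" "saddle_submatrix B B'"
proof -
  define D where "D = sel (dim_col B div 4) (filter (\<lambda>j'. B $$ (i, j') < B $$ (i, j)) [0..<dim_col B])"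
  define J where "J = {..<dim_col B} - D"
  have D: "D \<subseteq> {j'. j' < dim_col B \<and> B $$ (i, j') < B $$ (i, j)}"
    and J: "card J = dim_col B - dim_col B div 4"
    unfolding D_def J_def using piv valid_selection_filter[OF sel]
    by (simp_all add: horizontal_pivot_def)
  have sub: "{..<dim_row B} \<subseteq> {..<dim_row B}" "J \<subseteq> {..<dim_col B}"
    by (auto simp: J_def)
  let ?B = "submatrix B {..<dim_row B} J"
  have "submatrix B UNIV (- D) = ?B"
    by (subst submatrix_restrict) (simp add: J_def Diff_eq Int_commute)
  then have "delete_columns sel B i j = return_spmf (?B, 2 * dim_col B)"
    by (simp add: delete_columns_eq D_def)
  moreover have "saddle_submatrix B ?B"
    unfolding saddle_submatrix_def
  proof (intro conjI allI impI)
    show "\<exists>I K. I \<subseteq> {..<dim_row B} \<and> K \<subseteq> {..<dim_col B} \<and> ?B = submatrix B I K"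
      using sub by blast
    fix k l
    assume s: "strict_saddlepoint B k l"
    then obtain j' where "j' < dim_col B" "B $$ (i, j) \<le> B $$ (k, j')"
      using piv unfolding horizontal_pivot_def strict_saddlepoint_def by blast
    then have "B $$ (i, j) \<le> B $$ (k, l)"
      using s unfolding strict_saddlepoint_def by (cases "j' = l") force+
    also have "B $$ (k, l) \<le> B $$ (i, l)"
      using s piv unfolding strict_saddlepoint_def horizontal_pivot_def
      by (cases "k = i") (auto intro: less_imp_le)
    finally have "l \<notin> D" using D by auto
    then have "k \<in> {..<dim_row B}" "l \<in> J"
      using s by (auto simp: J_def strict_saddlepoint_def)
    then show "\<exists>i' j'. strict_saddlepoint ?B i' j' \<and> ?B $$ (i', j') = B $$ (k, l)"
      using strict_saddlepoint_submatrix[OF s _ _ sub] by metis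
  qed
  ultimately show ?thesis
    using that J by (simp add: submatrix_eq_mat[OF sub])
qed

text \<open>Dually, the column of a strict saddlepoint contains an entry at most the vertical pivot,
  so the saddlepoint is at most the pivot, and so is the entry where its row meets the pivot column.
  That row is no candidate for deletion.\<close>

lemma delete_rows_vertical_pivot:
  assumes piv: "vertical_pivot B i j" and sel: "valid_selection sel"
  obtains B' where "delete_rows sel B i j = return_spmf (B', 2 * dim_row B)"
    "dim_row B' = dim_row B - dim_row B div 4" "dim_col B' = dim_col B" "saddle_submatrix B B'"
proof -
  define D where "D = sel (dim_row B div 4) (filter (\<lambda>i'. B $$ (i, j) < B $$ (i', j)) [0..<dim_row B])"
  define I where "I = {..<dim_row B} - D"
  have D: "D \<subseteq> {i'. i' < dim_row B \<and> B $$ (i, j) < B $$ (i', j)}"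
    and I: "card I = dim_row B - dim_row B div 4"
    unfolding D_def I_def using piv valid_selection_filter[OF sel]
    by (simp_all add: vertical_pivot_def)
  have sub: "I \<subseteq> {..<dim_row B}" "{..<dim_col B} \<subseteq> {..<dim_col B}"
    by (auto simp: I_def)
  let ?B = "submatrix B I {..<dim_col B}"
  have "submatrix B (- D) UNIV = ?B"
    by (subst submatrix_restrict) (simp add: I_def Diff_eq Int_commute)
  then have "delete_rows sel B i j = return_spmf (?B, 2 * dim_row B)"
    by (simp add: delete_rows_eq D_def)
  moreover have "saddle_submatrix B ?B"
    unfolding saddle_submatrix_def
  proof (intro conjI allI impI)
    show "\<exists>K J. K \<subseteq> {..<dim_row B} \<and> J \<subseteq> {..<dim_col B} \<and> ?B = submatrix B K J"
      using sub by blast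
    fix k l
    assume s: "strict_saddlepoint B k l"
    have "B $$ (k, j) \<le> B $$ (k, l)"
      using s piv unfolding strict_saddlepoint_def vertical_pivot_def
      by (cases "l = j") (auto intro: less_imp_le)
    also obtain i' where "i' < dim_row B" "B $$ (i', l) \<le> B $$ (i, j)"
      using s piv unfolding vertical_pivot_def strict_saddlepoint_def by blast
    then have "B $$ (k, l) \<le> B $$ (i, j)"
      using s unfolding strict_saddlepoint_def by (cases "i' = k") force+
    finally have "k \<notin> D" using D by auto
    then have "k \<in> I" "l \<in> {..<dim_col B}"
      using s by (auto simp: I_def strict_saddlepoint_def)
    then show "\<exists>i' j'. strict_saddlepoint ?B i' j' \<and> ?B $$ (i', j') = B $$ (k, l)"
      using strict_saddlepoint_submatrix[OF s _ _ sub] by metis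
  qed
  ultimately show ?thesis
    using that I by (simp add: submatrix_eq_mat[OF sub])
qed

section \<open>The reduction\<close>

text \<open>Identifies the width left by the column deletion with the shape for which
  \<open>pivot_finder\<close> gives its guarantees.\<close>

lemma nat_ceiling_three_quarters: "nat \<lceil>3 * real m / 4\<rceil> = m - m div 4"
proof -
  have "\<lceil>3 * real m / 4\<rceil> = int (m - m div 4)"
    by (rule ceiling_unique) linarith+
  then show ?thesis by simp
qed

locale matrix_reduction =
  fixes c :: real and f :: "nat \<Rightarrow> real"
    and find_h find_v :: "'a::linorder pivot_algorithm"
    and sel_col sel_row :: selection_rule
  assumes f_antimono: "antimono f" and f_nonneg: "0 \<le> f m"
    and find_h: "pivot_finder horizontal_pivot c f find_h"
    and find_v: "pivot_finder vertical_pivot c f find_v"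
    and sel_col: "valid_selection sel_col"
    and sel_row: "valid_selection sel_row"
begin

abbreviation "reduce \<equiv> reduce_matrix find_h find_v sel_col sel_row"

section \<open>Loop invariants and the effect of one iteration\<close>

definition reducible :: "nat \<Rightarrow> 'a mat \<Rightarrow> bool" where
  "reducible m B \<longleftrightarrow> B \<in> carrier_mat m m \<and> distinct_entries B \<and> 0 < m"

text \<open>The state between the two pivot searches: columns are already deleted, rows are not, and
  \<open>m\<close> is still the side length at the start of the iteration.\<close>

definition semireduced :: "nat \<Rightarrow> 'a mat \<Rightarrow> bool" where
  "semireduced m B \<longleftrightarrow> B \<in> carrier_mat m (m - m div 4) \<and> distinct_entries B \<and> 0 < m"

text \<open>Every result other than \<open>None\<close> is a pivot, so success can be tracked as the
  bare event of not being \<open>None\<close>; the pivot property reenters through the support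
  condition when computations are composed.\<close>

lemma find_h_reducible:
  assumes "reducible m B"
  shows "runs_in_time (find_h B) (c * real m)"
    and "(Some (i, j), t) \<in> set_spmf (find_h B) \<Longrightarrow> horizontal_pivot B i j"
    and "1 - f m \<le> measure (measure_spmf (find_h B)) {(r, t). r \<noteq> None}"
proof -
  have *: "runs_in_time (find_h B) (c * real m)"
    "\<forall>(r, t) \<in> set_spmf (find_h B). r = None \<or> (\<exists>i j. r = Some (i, j) \<and> horizontal_pivot B i j)"
    "1 - f m \<le> measure (measure_spmf (find_h B)) {(r, t). \<exists>i j. r = Some (i, j) \<and> horizontal_pivot B i j}"
    using find_h assms unfolding pivot_finder_def reducible_def by blast+
  show "runs_in_time (find_h B) (c * real m)" by (rule *)
  show "(Some (i, j), t) \<in> set_spmf (find_h B) \<Longrightarrow> horizontal_pivot B i j"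
    using *(2) by fastforce
  have "measure (measure_spmf (find_h B)) {(r, t). \<exists>i j. r = Some (i, j) \<and> horizontal_pivot B i j}
    \<le> measure (measure_spmf (find_h B)) {(r, t). r \<noteq> None}"
    by (rule measure_spmf.finite_measure_mono) auto
  then show "1 - f m \<le> measure (measure_spmf (find_h B)) {(r, t). r \<noteq> None}"
    using *(3) by linarith
qed

lemma find_v_semireduced:
  assumes "semireduced m B"
  shows "runs_in_time (find_v B) (c * real m)"
    and "(Some (i, j), t) \<in> set_spmf (find_v B) \<Longrightarrow> vertical_pivot B i j"
    and "1 - f m \<le> measure (measure_spmf (find_v B)) {(r, t). r \<noteq> None}"
proof -
  have *: "runs_in_time (find_v B) (c * real m)"
    "\<forall>(r, t) \<in> set_spmf (find_v B). r = None \<or> (\<exists>i j. r = Some (i, j) \<and> vertical_pivot B i j)"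
    "1 - f m \<le> measure (measure_spmf (find_v B)) {(r, t). \<exists>i j. r = Some (i, j) \<and> vertical_pivot B i j}"
    using find_v assms unfolding pivot_finder_def semireduced_def nat_ceiling_three_quarters by blast+
  show "runs_in_time (find_v B) (c * real m)" by (rule *)
  show "(Some (i, j), t) \<in> set_spmf (find_v B) \<Longrightarrow> vertical_pivot B i j"
    using *(2) by fastforce
  have "measure (measure_spmf (find_v B)) {(r, t). \<exists>i j. r = Some (i, j) \<and> vertical_pivot B i j}
    \<le> measure (measure_spmf (find_v B)) {(r, t). r \<noteq> None}"
    by (rule measure_spmf.finite_measure_mono) auto
  then show "1 - f m \<le> measure (measure_spmf (find_v B)) {(r, t). r \<noteq> None}"
    using *(3) by linarith
qed

lemma delete_columns_reducible:
  assumes "reducible m B" "horizontal_pivot B i j"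
  obtains B' where "delete_columns sel_col B i j = return_spmf (B', 2 * m)"
    "semireduced m B'" "saddle_submatrix B B'"
  using delete_columns_horizontal_pivot[OF assms(2) sel_col] assms(1)
    distinct_entries_saddle_submatrix
  unfolding reducible_def semireduced_def by (metis carrier_matD carrier_matI)

lemma delete_rows_semireduced:
  assumes "semireduced m B" "vertical_pivot B i j"
  obtains B' where "delete_rows sel_row B i j = return_spmf (B', 2 * m)"
    "reducible (m - m div 4) B'" "saddle_submatrix B B'"
proof -
  have "0 < m - m div 4" using assms(1) by (simp add: semireduced_def)
  then show ?thesis
    using delete_rows_vertical_pivot[OF assms(2) sel_row] assms(1)
      distinct_entries_saddle_submatrix that
    unfolding reducible_def semireduced_def by (metis carrier_matD carrier_matI)
qed

section \<open>Partial correctness of the loop\<close>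

lemma reduce_sound:
  assumes "reducible m A" "(Some A', t) \<in> set_spmf (reduce A s)"
  shows "saddle_submatrix A A' \<and> dim_row A' \<le> s \<and> (\<exists>m'. reducible m' A')"
proof -
  let ?good = "\<lambda>B A'. saddle_submatrix B A' \<and> dim_row A' \<le> s \<and> (\<exists>m'. reducible m' A')"
  \<comment> \<open>A property of all outcomes in the support is vacuous for the empty
    subprobability and survives suprema of chains, so fixed-point induction applies even if the loop
    diverges. \<open>B\<close> is quantified because the recursive call receives a smaller
    matrix.\<close>
  let ?P = "\<lambda>r. \<forall>m B. reducible m B \<longrightarrow>
    (\<forall>x \<in> set_spmf (r find_h find_v sel_col sel_row B s). \<forall>A'. fst x = Some A' \<longrightarrow> ?good B A')"
  have "?P reduce_matrix"
  proof (induction rule: reduce_matrix.fixp_induct[where P = ?P])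
    case 1
    show ?case by (intro admissible_all admissible_imp) simp
  next
    case 2
    show ?case by simp
  next
    case (3 rec)
    show ?case
    proof (intro allI impI ballI)
      fix m B x C
      assume B: "reducible m B" and C: "fst x = Some C" and
        x: "x \<in> set_spmf (bind_timed (tick 1)
             (\<lambda>_. if dim_row B \<le> s then return_timed (Some B)
                  else bind_timed (find_h B)
                        (\<lambda>p. case p of None \<Rightarrow> return_timed None
                             | Some (i, j) \<Rightarrow>
                                 bind_timed (delete_columns sel_col B i j)
                                  (\<lambda>A1. bind_timed (find_v A1)
                                    (\<lambda>q. case q of None \<Rightarrow> return_timed None
                                         | Some (i', j') \<Rightarrow>
                                             bind_timed (delete_rows sel_row A1 i' j')
                                              (\<lambda>A2. rec find_h find_v sel_col sel_row A2 s))))))"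
      show "?good B C"
      proof (cases "dim_row B \<le> s")
        case True
        then have "C = B" using x C by (auto simp: set_bind_timed return_timed_def)
        then show ?thesis using True B saddle_submatrix_refl by blast
      next
        case False
        \<comment> \<open>A returned matrix excludes the \<open>None\<close> branches, so both pivot
          searches succeeded and their pivots are genuine.\<close>
        then obtain i j t u where h: "(Some (i, j), t) \<in> set_spmf (find_h B)"
          and u: "(Some C, u) \<in> set_spmf (bind_timed (delete_columns sel_col B i j)
                                  (\<lambda>A1. bind_timed (find_v A1)
                                    (\<lambda>q. case q of None \<Rightarrow> return_timed None
                                         | Some (i', j') \<Rightarrow>
                                             bind_timed (delete_rows sel_row A1 i' j')
                                              (\<lambda>A2. rec find_h find_v sel_col sel_row A2 s))))"
          using x C by (fastforce simp: set_bind_timed return_timed_def split: option.splits)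
        obtain B1 where B1: "delete_columns sel_col B i j = return_spmf (B1, 2 * m)"
          "semireduced m B1" "saddle_submatrix B B1"
          using delete_columns_reducible[OF B find_h_reducible(2)[OF B h]] .
        obtain i' j' t' u' where v: "(Some (i', j'), t') \<in> set_spmf (find_v B1)"
          and u': "(Some C, u') \<in> set_spmf (bind_timed (delete_rows sel_row B1 i' j')
                                  (\<lambda>A2. rec find_h find_v sel_col sel_row A2 s))"
          using u B1(1) by (fastforce simp: set_bind_timed return_timed_def split: option.splits)
        obtain B2 where B2: "delete_rows sel_row B1 i' j' = return_spmf (B2, 2 * m)"
          "reducible (m - m div 4) B2" "saddle_submatrix B1 B2"
          using delete_rows_semireduced[OF B1(2) find_v_semireduced(2)[OF B1(2) v]] .
        obtain w where "(Some C, w) \<in> set_spmf (rec find_h find_v sel_col sel_row B2 s)"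
          using u' B2(1) by (auto simp: set_bind_timed)
        then have "?good B2 C" using 3 B2(2) by fastforce
        then show ?thesis using B1(3) B2(3) saddle_submatrix_trans by blast
      qed
    qed
  qed
  then show ?thesis using assms by fastforce
qed

section \<open>Running time and failure probability\<close>

lemma reduce_return: "dim_row A \<le> s \<Longrightarrow> reduce A s = return_spmf (Some A, 1)"
  by (subst reduce_matrix.simps) (simp add: bind_timed_return_spmf tick_def return_timed_def)

text \<open>The ratio \<open>6 / 7\<close> comes from \<open>m div 4 \<ge> m / 7\<close> for \<open>m \<ge> 4\<close>, where \<open>m = 7\<close> is extremal.\<close>

lemma reduce_time_and_success:
  assumes "reducible m A" "3 \<le> s \<or> m \<le> s" "real m * (6 / 7) ^ N \<le> real s"
  shows "runs_in_time (reduce A s) (7 * (2 * \<bar>c\<bar> + 5) * real m + 1) \<and>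
    1 - real N * (2 * f s) \<le> measure (measure_spmf (reduce A s)) {(r, t). r \<noteq> None}"
  using assms
proof (induction N arbitrary: m A)
  case 0
  then have "reduce A s = return_spmf (Some A, 1)"
    by (intro reduce_return) (auto simp: reducible_def)
  then show ?case
    by (simp add: runs_in_time_return_spmf measure_return_spmf)
next
  case (Suc N)
  show ?case
  proof (cases "m \<le> s")
    case True
    then have "reduce A s = return_spmf (Some A, 1)"
      using Suc.prems(1) by (intro reduce_return) (auto simp: reducible_def)
    then show ?thesis
      using f_nonneg[of s] by (simp add: runs_in_time_return_spmf measure_return_spmf)
  next
    case False
    \<comment> \<open>One iteration costs at most \<open>?D * m\<close>: two pivot searches, two
      deletions of cost \<open>2 * m\<close> each, and the loop test, which is at most
      \<open>m\<close>. The factor 7 is the sum of the geometric series of ratio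
      \<open>6 / 7\<close>; the additive 1 pays for the last loop test.\<close>
    let ?D = "2 * \<bar>c\<bar> + 5" and ?m = "m - m div 4" and ?ok = "{(r, t). r \<noteq> None}"
    note A = Suc.prems(1)
    \<comment> \<open>For \<open>m < 4\<close> the loop would delete nothing, so this is where
      \<open>3 \<le> s\<close> enters.\<close>
    have m: "4 \<le> m" "s \<le> m" "3 \<le> s" using False Suc.prems(2) by auto
    have shrink: "real ?m \<le> 6 / 7 * real m"
    proof -
      have "m \<le> 7 * (m div 4)" using m(1) by presburger
      then have "real m \<le> 7 * real (m div 4)" by linarith
      then show ?thesis by (simp add: of_nat_diff)
    qed
    have "real ?m * (6 / 7) ^ N \<le> 6 / 7 * real m * (6 / 7) ^ N"
      using shrink by (intro mult_right_mono) auto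
    also have "\<dots> \<le> real s" using Suc.prems(3) by (simp add: mult.assoc mult.left_commute)
    finally have N: "real ?m * (6 / 7) ^ N \<le> real s" .
    \<comment> \<open>The loop body runs only while \<open>m\<close> exceeds \<open>s\<close>, so
      \<open>f s\<close> bounds every single failure probability.\<close>
    have fm: "f m \<le> f s" using f_antimono m(2) by (auto dest: antimonoD)
    have fs: "0 \<le> f s" by (rule f_nonneg)
    have cm: "c * real m \<le> \<bar>c\<bar> * real m" by (intro mult_right_mono) auto
    have IH: "runs_in_time (reduce B s) (6 * ?D * real m + 1) \<and>
        1 - real N * (2 * f s) \<le> measure (measure_spmf (reduce B s)) ?ok"
      if "reducible ?m B" for B
    proof -
      have "7 * ?D * real ?m + 1 \<le> 7 * ?D * (6 / 7 * real m) + 1"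
        using shrink by (intro add_right_mono mult_left_mono) auto
      then have "7 * ?D * real ?m + 1 \<le> 6 * ?D * real m + 1"
        by (simp add: algebra_simps)
      moreover have "runs_in_time (reduce B s) (7 * ?D * real ?m + 1) \<and>
        1 - real N * (2 * f s) \<le> measure (measure_spmf (reduce B s)) ?ok"
        using Suc.IH[OF that _ N] m(3) by blast
      ultimately show ?thesis unfolding runs_in_time_def by fastforce
    qed
    \<comment> \<open>The loop body is treated from its end: \<open>?last\<close>,
      \<open>?mid\<close>, \<open>?inner\<close> and \<open>?outer\<close> each prepend one more
      operation. Only the two pivot searches add to the failure probability, \<open>f s\<close>
      each.\<close>
    let ?last = "\<lambda>B1 i' j'. bind_timed (delete_rows sel_row B1 i' j') (\<lambda>B2. reduce B2 s)"
    let ?mid = "\<lambda>B1. bind_timed (find_v B1) (\<lambda>q. case q of None \<Rightarrow> return_timed None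
                     | Some (i', j') \<Rightarrow> ?last B1 i' j')"
    have last: "runs_in_time (?last B i j) (2 * real m + (6 * ?D * real m + 1))"
      "1 - real N * (2 * f s) \<le> measure (measure_spmf (?last B i j)) ?ok"
      if B: "semireduced m B" and ij: "vertical_pivot B i j" for B i j
    proof -
      obtain B2 where B2: "delete_rows sel_row B i j = return_spmf (B2, 2 * m)" "reducible ?m B2"
        using delete_rows_semireduced[OF B ij] by metis
      show "runs_in_time (?last B i j) (2 * real m + (6 * ?D * real m + 1))"
        unfolding B2(1) using IH[OF B2(2)]
        by (intro runs_in_time_bind_timed[where T="2 * real m"])
          (auto simp: runs_in_time_return_spmf)
      \<comment> \<open>The deletion never fails, hence \<open>d = 0\<close> and the trivial
        predicate for the first stage.\<close>
      show "1 - real N * (2 * f s) \<le> measure (measure_spmf (?last B i j)) ?ok"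
        unfolding B2(1) using IH[OF B2(2)] fs
        by (intro measure_bind_timed_ge[where d=0 and e="real N * (2 * f s)" and P="\<lambda>_. True"])
          (auto simp: measure_return_spmf)
    qed
    have mid: "runs_in_time (?mid B) (\<bar>c\<bar> * real m + (2 * real m + (6 * ?D * real m + 1)))"
      "1 - (f s + real N * (2 * f s)) \<le> measure (measure_spmf (?mid B)) ?ok"
      if B: "semireduced m B" for B
    proof -
      show "runs_in_time (?mid B) (\<bar>c\<bar> * real m + (2 * real m + (6 * ?D * real m + 1)))"
        using last(1)[OF B find_v_semireduced(2)[OF B]] cm
        by (intro runs_in_time_bind_timed[OF find_v_semireduced(1)[OF B],
              where U="2 * real m + (6 * ?D * real m + 1)"])
          (auto simp: runs_in_time_return_spmf return_timed_def split: option.splits)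
      show "1 - (f s + real N * (2 * f s)) \<le> measure (measure_spmf (?mid B)) ?ok"
        using last(2)[OF B find_v_semireduced(2)[OF B]] fm fs f_nonneg[of m]
        by (intro measure_bind_timed_ge[OF find_v_semireduced(3)[OF B], where e="real N * (2 * f s)"]) auto
    qed
    let ?inner = "\<lambda>i j. bind_timed (delete_columns sel_col A i j) ?mid"
    have inner: "runs_in_time (?inner i j)
        (2 * real m + (\<bar>c\<bar> * real m + (2 * real m + (6 * ?D * real m + 1))))"
      "1 - (f s + real N * (2 * f s)) \<le> measure (measure_spmf (?inner i j)) ?ok"
      if ij: "horizontal_pivot A i j" for i j
    proof -
      obtain B1 where B1: "delete_columns sel_col A i j = return_spmf (B1, 2 * m)" "semireduced m B1"
        using delete_columns_reducible[OF A ij] by metis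
      show "runs_in_time (?inner i j)
        (2 * real m + (\<bar>c\<bar> * real m + (2 * real m + (6 * ?D * real m + 1))))"
        unfolding B1(1)
        by (rule runs_in_time_bind_timed[where T="2 * real m"
              and U="\<bar>c\<bar> * real m + (2 * real m + (6 * ?D * real m + 1))"])
          (use mid(1)[OF B1(2)] in \<open>auto simp: runs_in_time_return_spmf\<close>)
      show "1 - (f s + real N * (2 * f s)) \<le> measure (measure_spmf (?inner i j)) ?ok"
        unfolding B1(1)
        by (rule measure_bind_timed_ge[where d=0 and e="f s + real N * (2 * f s)" and P="\<lambda>_. True"])
          (use mid(2)[OF B1(2)] fs in \<open>auto simp: measure_return_spmf\<close>)
    qed
    let ?outer = "bind_timed (find_h A) (\<lambda>p. case p of None \<Rightarrow> return_timed None
                     | Some (i, j) \<Rightarrow> ?inner i j)"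
    have outer: "runs_in_time ?outer
        (\<bar>c\<bar> * real m + (2 * real m + (\<bar>c\<bar> * real m + (2 * real m + (6 * ?D * real m + 1)))))"
      using inner(1)[OF find_h_reducible(2)[OF A]] cm
      by (intro runs_in_time_bind_timed[OF find_h_reducible(1)[OF A],
            where U="2 * real m + (\<bar>c\<bar> * real m + (2 * real m + (6 * ?D * real m + 1)))"])
        (auto simp: runs_in_time_return_spmf return_timed_def split: option.splits)
    have outer': "1 - (f s + (f s + real N * (2 * f s))) \<le> measure (measure_spmf ?outer) ?ok"
      using inner(2)[OF find_h_reducible(2)[OF A]] fm fs f_nonneg[of m]
      by (intro measure_bind_timed_ge[OF find_h_reducible(3)[OF A], where e="f s + real N * (2 * f s)"]) auto
    have eq: "reduce A s = bind_timed (return_spmf ((), 1)) (\<lambda>_. ?outer)"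
      using False A by (subst reduce_matrix.simps) (auto simp: tick_def reducible_def)
    have "runs_in_time (reduce A s) (7 * ?D * real m + 1)"
      unfolding eq
      by (rule runs_in_time_bind_timed[where T=1, OF _ outer])
        (use m(1) in \<open>auto simp: runs_in_time_return_spmf algebra_simps\<close>)
    moreover have "1 - real (Suc N) * (2 * f s) \<le> measure (measure_spmf (reduce A s)) ?ok"
      unfolding eq
      by (rule measure_bind_timed_ge[where d=0 and P="\<lambda>_. True", OF _ outer'])
        (use fs in \<open>auto simp: measure_return_spmf algebra_simps\<close>)
    ultimately show ?thesis by blast
  qed
qed

text \<open>By soundness, each returned matrix in the support already has the required form, with
  its own height as witness for \<open>s'\<close>; the two events agree up to null sets.\<close>

lemma reduce_success:
  assumes "reducible m A"
  shows "measure (measure_spmf (reduce A s)) {(r, t). r \<noteq> None} \<le>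
    measure (measure_spmf (reduce A s)) {(r, t). \<exists>A' s'. r = Some A' \<and> square_submatrix A' s' A \<and> s' \<le> s}"
proof (rule measure_spmf.finite_measure_mono_AE)
  have "square_submatrix A' (dim_row A') A \<and> dim_row A' \<le> s" if "(Some A', t) \<in> set_spmf (reduce A s)" for A' t
    using reduce_sound[OF assms that] square_submatrix_saddle_submatrix
    unfolding reducible_def by (metis carrier_matD)
  then show "AE x in measure_spmf (reduce A s). x \<in> {(r, t). r \<noteq> None} \<longrightarrow>
    x \<in> {(r, t). \<exists>A' s'. r = Some A' \<and> square_submatrix A' s' A \<and> s' \<le> s}"
    by (fastforce simp: AE_measure_spmf_iff)
qed simp

end

section \<open>Counting iterations and assembling the bounds\<close>

lemma iterations_bound:
  assumes "0 < s" "s \<le> n"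
  shows "real n * (6 / 7) ^ (5 * nat \<lceil>log 2 (real n / real s)\<rceil>) \<le> real s"
proof -
  \<comment> \<open>The number of halvings that bring \<open>n\<close> down to at most
    \<open>s\<close>.\<close>
  let ?k = "nat \<lceil>log 2 (real n / real s)\<rceil>"
  have pos: "0 < real n / real s" using assms by simp
  have "log 2 (real n / real s) \<le> real ?k" by (rule real_nat_ceiling_ge)
  then have "real n / real s \<le> 2 powr real ?k" using pos by (simp add: log_le_iff)
  then have n: "real n \<le> 2 ^ ?k * real s" using assms(1) by (simp add: powr_realpow field_simps)
  \<comment> \<open>\<open>(6 / 7) ^ 5\<close> equals \<open>7776 / 16807\<close>, which is below
    one half.\<close>
  have "((6 / 7) ^ 5) ^ ?k \<le> (1 / 2 :: real) ^ ?k" by (rule power_mono) (simp_all add: power_divide)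
  then have "real n * (6 / 7) ^ (5 * ?k) \<le> real n * (1 / 2) ^ ?k"
    by (simp add: power_mult mult_left_mono)
  also have "\<dots> \<le> real s" using n by (simp add: power_divide field_simps)
  finally show ?thesis .
qed

text \<open>\<open>C\<close> is absolute and \<open>K\<close> depends only on the constant
  \<open>c\<close> of the pivot finders. The logarithm is rounded up because even for
  \<open>s\<close> just below \<open>n\<close> one iteration can fail. A side length of at most 3
  cannot shrink, whence the restriction on \<open>s\<close> for time and success; the saddlepoint
  claim concerns returned matrices only.\<close>

theorem theorem3:
  shows "\<exists>C::real. \<forall>c::real. \<exists>K::real.
    \<forall>(f :: nat \<Rightarrow> real) (find_h :: 'a::linorder pivot_algorithm) (find_v :: 'a pivot_algorithm)
     (sel_col :: selection_rule) (sel_row :: selection_rule) (n::nat) (s::nat) (A :: 'a mat).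
      antimono f \<and> (\<forall>m. f m \<in> {0..1}) \<and>
      pivot_finder horizontal_pivot c f find_h \<and>
      pivot_finder vertical_pivot c f find_v \<and>
      valid_selection sel_col \<and> valid_selection sel_row \<and>
      A \<in> carrier_mat n n \<and> distinct_entries A \<and> 0 < s \<and> s \<le> n \<longrightarrow>
      (3 \<le> s \<or> s = n \<longrightarrow>
         runs_in_time (reduce_matrix find_h find_v sel_col sel_row A s) (K * real n) \<and>
         1 - C * (f s * \<lceil>log 2 (real n / real s)\<rceil>)
           \<le> measure (measure_spmf (reduce_matrix find_h find_v sel_col sel_row A s))
               {(r, t). \<exists>A' s'. r = Some A' \<and> square_submatrix A' s' A \<and> s' \<le> s}) \<and>
      (\<forall>A' t i j. (Some A', t) \<in> set_spmf (reduce_matrix find_h find_v sel_col sel_row A s) \<and>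
         strict_saddlepoint A i j \<longrightarrow>
           (\<exists>i' j'. strict_saddlepoint A' i' j' \<and> A' $$ (i', j') = A $$ (i, j)))"
proof (rule exI[of _ 10], intro allI)
  fix c :: real
  show "\<exists>K::real.
    \<forall>(f :: nat \<Rightarrow> real) (find_h :: 'a::linorder pivot_algorithm) (find_v :: 'a pivot_algorithm)
     (sel_col :: selection_rule) (sel_row :: selection_rule) (n::nat) (s::nat) (A :: 'a mat).
      antimono f \<and> (\<forall>m. f m \<in> {0..1}) \<and>
      pivot_finder horizontal_pivot c f find_h \<and>
      pivot_finder vertical_pivot c f find_v \<and>
      valid_selection sel_col \<and> valid_selection sel_row \<and>
      A \<in> carrier_mat n n \<and> distinct_entries A \<and> 0 < s \<and> s \<le> n \<longrightarrow>
      (3 \<le> s \<or> s = n \<longrightarrow>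
         runs_in_time (reduce_matrix find_h find_v sel_col sel_row A s) (K * real n) \<and>
         1 - 10 * (f s * \<lceil>log 2 (real n / real s)\<rceil>)
           \<le> measure (measure_spmf (reduce_matrix find_h find_v sel_col sel_row A s))
               {(r, t). \<exists>A' s'. r = Some A' \<and> square_submatrix A' s' A \<and> s' \<le> s}) \<and>
      (\<forall>A' t i j. (Some A', t) \<in> set_spmf (reduce_matrix find_h find_v sel_col sel_row A s) \<and>
         strict_saddlepoint A i j \<longrightarrow>
           (\<exists>i' j'. strict_saddlepoint A' i' j' \<and> A' $$ (i', j') = A $$ (i, j)))"
  \<comment> \<open>The final \<open>+ 1\<close> absorbs the additive constant of the time bound, as
    \<open>n\<close> is positive.\<close>
  proof (rule exI[of _ "7 * (2 * \<bar>c\<bar> + 5) + 1"], intro allI impI, elim conjE, intro conjI impI allI)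
    fix f :: "nat \<Rightarrow> real" and find_h find_v :: "'a pivot_algorithm"
      and sel_col sel_row :: selection_rule and n s :: nat and A :: "'a mat"
    assume hyps: "antimono f" "\<forall>m. f m \<in> {0..1}" "pivot_finder horizontal_pivot c f find_h"
      "pivot_finder vertical_pivot c f find_v" "valid_selection sel_col" "valid_selection sel_row"
      and A: "A \<in> carrier_mat n n" "distinct_entries A" and s: "0 < s" "s \<le> n"
    interpret matrix_reduction c f find_h find_v sel_col sel_row
      by unfold_locales (use hyps in auto)
    have red: "reducible n A" using A s by (simp add: reducible_def)
    {
      assume "3 \<le> s \<or> s = n"
      then have "3 \<le> s \<or> n \<le> s" by auto
      note bounds = reduce_time_and_success[OF red this iterations_bound[OF s]]
      have "7 * (2 * \<bar>c\<bar> + 5) * real n + 1 \<le> (7 * (2 * \<bar>c\<bar> + 5) + 1) * real n"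
        using s by (simp add: algebra_simps)
      then show "runs_in_time (reduce A s) ((7 * (2 * \<bar>c\<bar> + 5) + 1) * real n)"
        using bounds unfolding runs_in_time_def by fastforce
      \<comment> \<open>Nonnegativity ensures that \<open>nat\<close> does not truncate, so the
        iteration count agrees with the rounded logarithm.\<close>
      have "0 \<le> \<lceil>log 2 (real n / real s)\<rceil>"
        using s by (simp add: less_le_trans[of _ 0])
      then have "1 - 10 * (f s * \<lceil>log 2 (real n / real s)\<rceil>) =
        1 - real (5 * nat \<lceil>log 2 (real n / real s)\<rceil>) * (2 * f s)"
        by simp
      then show "1 - 10 * (f s * \<lceil>log 2 (real n / real s)\<rceil>) \<le> measure (measure_spmf (reduce A s))
          {(r, t). \<exists>A' s'. r = Some A' \<and> square_submatrix A' s' A \<and> s' \<le> s}"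
        using bounds reduce_success[OF red, of s] by linarith
    }
    fix A' t i j
    assume "(Some A', t) \<in> set_spmf (reduce A s) \<and> strict_saddlepoint A i j"
    then show "\<exists>i' j'. strict_saddlepoint A' i' j' \<and> A' $$ (i', j') = A $$ (i, j)"
      using reduce_sound[OF red] unfolding saddle_submatrix_def by blast
  qed
qed

end
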